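(* (1) $\mathrm{BMTL}[F,P]\not\subseteq\mathrm{TTL}[X_\theta,Y_\theta]$. (2) $\mathrm{MITL}[F,P]\not\subseteq\mathrm{TTL}[X_\theta,Y_\theta]$. That is, in each case there is a formula $\phi$ of the first logic such that no TTL$[X_\theta,Y_\theta]$ formula $\psi$ defines the same language $\mathcal{L}(\psi)=\mathcal{L}(\phi)$.
   Context: Fix a finite alphabet $\Sigma$. A timed word is $\rho=(\sigma_1,\tau_1)\cdots(\sigma_n,\tau_n)$, $n\ge1$, $\sigma_i\in\Sigma$, $\tau_i\in\mathbb{R}_{\ge0}$, $\tau_1=0$, $\tau_i\le\tau_{i+1}$. An interval is a convex subset of $\mathbb{R}_{\ge0}$ with endpoints non-negative integers or $\infty$ (finite ends open or closed); singular if of form $[c,c]$; bounded if it does not extend to $\infty$. MTL$[F,P]$ formulas: $\psi::=a\mid\psi\wedge\psi\mid\neg\psi\mid F_I\psi\mid P_I\psi$, with $\rho,i\models a$ iff $\sigma_i=a$, $\rho,i\models F_I\psi$ iff $\exists j>i$: $\tau_j-\tau_i\in I$, $\rho,j\models\psi$; $\rho,i\models P_I\psi$ iff $\exists j<i$: $\tau_i-\tau_j\in I$, $\rho,j\models\psi$; $\mathcal{L}(\psi)=\{\rho:\rho,1\models\psi\}$. BMTL$[F,P]$ allows only bounded intervals, MITL$[F,P]$ only non-singular ones. TTL$[X_\theta,Y_\theta]$: freeze variables from a finite set $\mathcal{X}$; valuations $\nu:\mathcal{X}\to\mathbb{R}_{\ge0}$, $\nu_0\equiv0$; guards $g::=g\wedge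 g\mid x-T\approx c$ ($\approx\in\{<,\le,>,\ge,=\}$, $c\in\mathbb{Z}$), $\nu,t\models x-T\approx c$ iff $\nu(x)-t\approx c$; guarded events $\theta=(a,g)$; formulas $\phi::=\top\mid\theta\mid SP\phi\mid EP\phi\mid X_\theta\phi\mid Y_\theta\phi\mid x.\phi\mid\phi\vee\phi\mid\neg\phi$, with $\rho,i,\nu\models\theta$ iff $\sigma_i=a$ and $\nu,\tau_i\models g$; $\rho,i,\nu\models SP\phi$ iff $\rho,1,\nu\models\phi$; $\rho,i,\nu\models EP\phi$ iff $\rho,\#\rho,\nu\models\phi$; $\rho,i,\nu\models X_\theta\phi$ iff there is $j>i$ with $\rho,j,\nu\models\theta$, $\rho,k,\nu\not\models\theta$ for all $i<k<j$, and $\rho,j,\nu\models\phi$; $Y_\theta$ symmetric to the left; $\rho,i,\nu\models x.\phi$ iff $\rho,i,\nu[x\mapsto\tau_i]\models\phi$; $\mathcal{L}(\phi)=\{\rho:\rho,1,\nu_0\models\phi\}$. *)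

theory Defs
  imports Complex_Main
begin

text \<open>Positions are list indices, so the positions \<open>1, \<dots>, n\<close> of the usual notation are
  \<open>0, \<dots>, n - 1\<close> here.\<close>

type_synonym 'a tword = "('a \<times> real) list"

abbreviation letter :: "'a tword \<Rightarrow> nat \<Rightarrow> 'a" where
  "letter \<rho> i \<equiv> fst (\<rho> ! i)"

abbreviation stamp :: "'a tword \<Rightarrow> nat \<Rightarrow> real" where
  "stamp \<rho> i \<equiv> snd (\<rho> ! i)"

definition timed_word :: "'a tword \<Rightarrow> bool" where
  "timed_word \<rho> \<longleftrightarrow>
     length \<rho> \<ge> 1 \<and> (\<forall>i < length \<rho>. 0 \<le> stamp \<rho> i) \<and> stamp \<rho> 0 = 0 \<and>
     (\<forall>i. Suc i < length \<rho> \<longrightarrow> stamp \<rho> i \<le> stamp \<rho> (Suc i))"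


text \<open>In the constructor suffixes, \<open>C\<close> and \<open>O\<close> stand for a closed and an open end (left end first)
  and \<open>Inf\<close> for an infinite right end.\<close>

datatype ivl = IvlCC nat nat | IvlCO nat nat | IvlOC nat nat | IvlOO nat nat | IvlCInf nat | IvlOInf nat

fun ivl_set :: "ivl \<Rightarrow> real set" where
  "ivl_set (IvlCC l u) = {real l..real u}"
| "ivl_set (IvlCO l u) = {real l..<real u}"
| "ivl_set (IvlOC l u) = {real l<..real u}"
| "ivl_set (IvlOO l u) = {real l<..<real u}"
| "ivl_set (IvlCInf l) = {real l..}"
| "ivl_set (IvlOInf l) = {real l<..}"

definition ivl_singular :: "ivl \<Rightarrow> bool" where
  "ivl_singular I \<longleftrightarrow> (\<exists>c. ivl_set I = {c..c})"

definition ivl_bounded :: "ivl \<Rightarrow> bool" where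
  "ivl_bounded I \<longleftrightarrow> bdd_above (ivl_set I)"

datatype 'a mtl =
    MAtom 'a
  | MAnd "'a mtl" "'a mtl"
  | MNot "'a mtl"
  | MF ivl "'a mtl"
  | MP ivl "'a mtl"

primrec mtl_sat :: "'a tword \<Rightarrow> nat \<Rightarrow> 'a mtl \<Rightarrow> bool" where
  "mtl_sat \<rho> i (MAtom a) \<longleftrightarrow> letter \<rho> i = a"
| "mtl_sat \<rho> i (MAnd \<phi> \<psi>) \<longleftrightarrow> mtl_sat \<rho> i \<phi> \<and> mtl_sat \<rho> i \<psi>"
| "mtl_sat \<rho> i (MNot \<phi>) \<longleftrightarrow> \<not> mtl_sat \<rho> i \<phi>"
| "mtl_sat \<rho> i (MF I \<phi>) \<longleftrightarrow>
     (\<exists>j. i < j \<and> j < length \<rho> \<and> stamp \<rho> j - stamp \<rho> i \<in> ivl_set I \<and> mtl_sat \<rho> j \<phi>)"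
| "mtl_sat \<rho> i (MP I \<phi>) \<longleftrightarrow>
     (\<exists>j. j < i \<and> stamp \<rho> i - stamp \<rho> j \<in> ivl_set I \<and> mtl_sat \<rho> j \<phi>)"

definition mtl_lang :: "'a mtl \<Rightarrow> 'a tword set" where
  "mtl_lang \<phi> = {\<rho>. timed_word \<rho> \<and> mtl_sat \<rho> 0 \<phi>}"

primrec mtl_ivls :: "'a mtl \<Rightarrow> ivl set" where
  "mtl_ivls (MAtom a) = {}"
| "mtl_ivls (MAnd \<phi> \<psi>) = mtl_ivls \<phi> \<union> mtl_ivls \<psi>"
| "mtl_ivls (MNot \<phi>) = mtl_ivls \<phi>"
| "mtl_ivls (MF I \<phi>) = insert I (mtl_ivls \<phi>)"
| "mtl_ivls (MP I \<phi>) = insert I (mtl_ivls \<phi>)"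

definition BMTL :: "'a mtl set" where
  "BMTL = {\<phi>. \<forall>I \<in> mtl_ivls \<phi>. ivl_bounded I}"

definition MITL :: "'a mtl set" where
  "MITL = {\<phi>. \<forall>I \<in> mtl_ivls \<phi>. \<not> ivl_singular I}"


text \<open>Freeze variables are drawn from \<^typ>\<open>nat\<close>. A formula mentions only finitely many of them,
  so the formulas below are those over all finite sets of freeze variables. Valuations start
  at \<open>0\<close> and are updated with time stamps only, hence stay non-negative.\<close>

type_synonym fvar = nat
type_synonym valuation = "fvar \<Rightarrow> real"

datatype cmp = Lt | Le | Gt | Ge | Eq

fun cmp_sat :: "cmp \<Rightarrow> real \<Rightarrow> real \<Rightarrow> bool" where
  "cmp_sat Lt r s \<longleftrightarrow> r < s"
| "cmp_sat Le r s \<longleftrightarrow> r \<le> s"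
| "cmp_sat Gt r s \<longleftrightarrow> r > s"
| "cmp_sat Ge r s \<longleftrightarrow> r \<ge> s"
| "cmp_sat Eq r s \<longleftrightarrow> r = s"

text \<open>\<open>GCmp x R c\<close> is the guard \<open>x - T R c\<close>, where \<open>T\<close> is the current time.\<close>

datatype guard = GAnd guard guard | GCmp fvar cmp int

primrec guard_sat :: "valuation \<Rightarrow> real \<Rightarrow> guard \<Rightarrow> bool" where
  "guard_sat \<nu> t (GAnd g h) \<longleftrightarrow> guard_sat \<nu> t g \<and> guard_sat \<nu> t h"
| "guard_sat \<nu> t (GCmp x R c) \<longleftrightarrow> cmp_sat R (\<nu> x - t) (real_of_int c)"

type_synonym 'a gevent = "'a \<times> guard"

definition gevent_sat :: "'a tword \<Rightarrow> nat \<Rightarrow> valuation \<Rightarrow> 'a gevent \<Rightarrow> bool" where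
  "gevent_sat \<rho> i \<nu> \<theta> \<longleftrightarrow> letter \<rho> i = fst \<theta> \<and> guard_sat \<nu> (stamp \<rho> i) (snd \<theta>)"

datatype 'a ttl =
    TTop
  | TEvent "'a gevent"
  | TSP "'a ttl"
  | TEP "'a ttl"
  | TX "'a gevent" "'a ttl"
  | TY "'a gevent" "'a ttl"
  | TFreeze fvar "'a ttl"
  | TOr "'a ttl" "'a ttl"
  | TNot "'a ttl"

primrec ttl_sat :: "'a tword \<Rightarrow> nat \<Rightarrow> valuation \<Rightarrow> 'a ttl \<Rightarrow> bool" where
  "ttl_sat \<rho> i \<nu> TTop \<longleftrightarrow> True"
| "ttl_sat \<rho> i \<nu> (TEvent \<theta>) \<longleftrightarrow> gevent_sat \<rho> i \<nu> \<theta>"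
| "ttl_sat \<rho> i \<nu> (TSP \<phi>) \<longleftrightarrow> ttl_sat \<rho> 0 \<nu> \<phi>"
| "ttl_sat \<rho> i \<nu> (TEP \<phi>) \<longleftrightarrow> ttl_sat \<rho> (length \<rho> - 1) \<nu> \<phi>"
| "ttl_sat \<rho> i \<nu> (TX \<theta> \<phi>) \<longleftrightarrow>
     (\<exists>j. i < j \<and> j < length \<rho> \<and> gevent_sat \<rho> j \<nu> \<theta> \<and>
          (\<forall>k. i < k \<and> k < j \<longrightarrow> \<not> gevent_sat \<rho> k \<nu> \<theta>) \<and> ttl_sat \<rho> j \<nu> \<phi>)"
| "ttl_sat \<rho> i \<nu> (TY \<theta> \<phi>) \<longleftrightarrow>
     (\<exists>j. j < i \<and> gevent_sat \<rho> j \<nu> \<theta> \<and>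
          (\<forall>k. j < k \<and> k < i \<longrightarrow> \<not> gevent_sat \<rho> k \<nu> \<theta>) \<and> ttl_sat \<rho> j \<nu> \<phi>)"
| "ttl_sat \<rho> i \<nu> (TFreeze x \<phi>) \<longleftrightarrow> ttl_sat \<rho> i (\<nu>(x := stamp \<rho> i)) \<phi>"
| "ttl_sat \<rho> i \<nu> (TOr \<phi> \<psi>) \<longleftrightarrow> ttl_sat \<rho> i \<nu> \<phi> \<or> ttl_sat \<rho> i \<nu> \<psi>"
| "ttl_sat \<rho> i \<nu> (TNot \<phi>) \<longleftrightarrow> \<not> ttl_sat \<rho> i \<nu> \<phi>"

definition ttl_lang :: "'a ttl \<Rightarrow> 'a tword set" where
  "ttl_lang \<phi> = {\<rho>. timed_word \<rho> \<and> ttl_sat \<rho> 0 (\<lambda>_. 0) \<phi>}"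

end

theory Submission
  imports Defs
begin

text \<open>
  A TTL formula is parsed deterministically: each occurrence of a subformula is evaluated at one
  position only. Over a single letter, the position selected by \<open>X\<^sub>\<theta>\<close> or \<open>Y\<^sub>\<theta>\<close> is a neighbour either
  of the current position or of an integer shift, by a constant of the formula, of a time stamp
  frozen earlier. Hence a formula of depth \<open>D\<close> sees only positions that are reached from the two ends
  of the word by \<open>D\<close> such steps, and it cannot notice a change of a time stamp far away from these.

  For BMTL, \<open>F\<^bsub>(0,1)\<^esub> F\<^bsub>[1,1]\<^esub> a\<close> detects that among many time stamps in \<open>(1,2)\<close> a single one is moved
  onto the shift by \<open>1\<close> of a time stamp in \<open>(0,1)\<close>. For MITL, \<open>F\<^bsub>[0,\<infinity>)\<^esub> F\<^bsub>(1,2)\<^esub> a\<close> detects that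
  in a long word with gaps \<open>3\<close> a single time stamp is moved by \<open>3/2\<close>.
\<close>

section \<open>Timed words over one letter\<close>

text \<open>With a single letter, guarded events differ only through their guards.\<close>

definition unary_word :: "'a \<Rightarrow> nat \<Rightarrow> (nat \<Rightarrow> real) \<Rightarrow> 'a tword" where
  "unary_word a n s = map (\<lambda>i. (a, s i)) [0..<n]"

lemma length_unary_word [simp]: "length (unary_word a n s) = n"
  by (simp add: unary_word_def)

lemma nth_unary_word [simp]: "i < n \<Longrightarrow> unary_word a n s ! i = (a, s i)"
  by (simp add: unary_word_def)

lemma timed_word_unary_word:
  assumes "n \<ge> 1" and "s 0 = 0" and mono: "\<And>i. Suc i < n \<Longrightarrow> s i \<le> s (Suc i)"
  shows "timed_word (unary_word a n s)"
proof -
  have "0 \<le> s i" if "i < n" for i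
    using that
  proof (induction i)
    case (Suc i)
    then show ?case using mono[of i] by simp
  qed (simp add: assms)
  then show ?thesis
    using assms by (auto simp: timed_word_def)
qed

section \<open>Constants and depth of TTL formulas\<close>

primrec guard_bound :: "guard \<Rightarrow> int" where
  "guard_bound (GAnd g h) = max (guard_bound g) (guard_bound h)"
| "guard_bound (GCmp x R c) = \<bar>c\<bar>"

primrec ttl_bound :: "'a ttl \<Rightarrow> int" where
  "ttl_bound TTop = 0"
| "ttl_bound (TEvent \<theta>) = guard_bound (snd \<theta>)"
| "ttl_bound (TSP \<phi>) = ttl_bound \<phi>"
| "ttl_bound (TEP \<phi>) = ttl_bound \<phi>"
| "ttl_bound (TX \<theta> \<phi>) = max (guard_bound (snd \<theta>)) (ttl_bound \<phi>)"
| "ttl_bound (TY \<theta> \<phi>) = max (guard_bound (snd \<theta>)) (ttl_bound \<phi>)"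
| "ttl_bound (TFreeze x \<phi>) = ttl_bound \<phi>"
| "ttl_bound (TOr \<phi> \<psi>) = max (ttl_bound \<phi>) (ttl_bound \<psi>)"
| "ttl_bound (TNot \<phi>) = ttl_bound \<phi>"

text \<open>Only \<open>TX\<close> and \<open>TY\<close> count: \<open>TSP\<close> and
  \<open>TEP\<close> jump to the ends, which are reachable at every level, and freezing does not
  move.\<close>

primrec ttl_depth :: "'a ttl \<Rightarrow> nat" where
  "ttl_depth TTop = 0"
| "ttl_depth (TEvent \<theta>) = 0"
| "ttl_depth (TSP \<phi>) = ttl_depth \<phi>"
| "ttl_depth (TEP \<phi>) = ttl_depth \<phi>"
| "ttl_depth (TX \<theta> \<phi>) = Suc (ttl_depth \<phi>)"
| "ttl_depth (TY \<theta> \<phi>) = Suc (ttl_depth \<phi>)"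
| "ttl_depth (TFreeze x \<phi>) = ttl_depth \<phi>"
| "ttl_depth (TOr \<phi> \<psi>) = max (ttl_depth \<phi>) (ttl_depth \<psi>)"
| "ttl_depth (TNot \<phi>) = ttl_depth \<phi>"

lemma guard_bound_nonneg: "0 \<le> guard_bound g"
  by (induction g) auto

lemma ttl_bound_nonneg: "0 \<le> ttl_bound \<phi>"
  by (induction \<phi>) (auto simp: guard_bound_nonneg le_max_iff_disj)

text \<open>Some comparison in \<open>g\<close> flips between the times \<open>t\<close> and
  \<open>t'\<close>, so its threshold lies between them. The interval is closed to cover strict,
  weak and equality comparisons alike.\<close>

lemma guard_sat_differ:
  assumes "guard_sat \<nu> t g \<noteq> guard_sat \<nu> t' g"
  shows "\<exists>x c. \<bar>c\<bar> \<le> guard_bound g \<and> \<nu> x - of_int c \<in> {min t t'..max t t'}"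
  using assms
proof (induction g)
  case (GAnd g h)
  then consider "guard_sat \<nu> t g \<noteq> guard_sat \<nu> t' g" | "guard_sat \<nu> t h \<noteq> guard_sat \<nu> t' h"
    by auto
  then show ?case
    by cases (use GAnd.IH in \<open>fastforce simp: le_max_iff_disj\<close>)+
next
  case (GCmp x R c)
  then have "\<nu> x - of_int c \<in> {min t t'..max t t'}"
    by (cases R) auto
  then show ?case
    by auto
qed

section \<open>Invariance under a hidden change of one time stamp\<close>

text \<open>\<open>R d\<close> contains the positions that are reachable within \<open>d\<close> steps; the time stamp at position
  \<open>k\<close> is changed to \<open>t\<close>.\<close>

locale hidden_change =
  fixes n k D :: nat and s :: "nat \<Rightarrow> real" and t :: real and M :: int and R :: "nat \<Rightarrow> nat set"
  assumes first_reachable: "0 \<in> R d"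
    and last_reachable: "n - 1 \<in> R d"
    and reachable_bounded: "i \<in> R d \<Longrightarrow> i < n"
    and reachable_mono: "R d \<subseteq> R (Suc d)"
    and reachable_succ: "\<lbrakk>i \<in> R d; Suc i < n\<rbrakk> \<Longrightarrow> Suc i \<in> R (Suc d)"
    and reachable_pred: "Suc i \<in> R d \<Longrightarrow> i \<in> R (Suc d)"
    and reachable_shift: "\<lbrakk>p \<in> R d; \<bar>c\<bar> \<le> M; Suc j < n;
          s p - of_int c \<in> {min (s j) (s (Suc j))..max (s j) (s (Suc j))}\<rbrakk>
        \<Longrightarrow> j \<in> R (Suc d) \<and> Suc j \<in> R (Suc d)"
    and hidden: "d \<le> D \<Longrightarrow> k \<notin> R d"
    and hidden_shift: "\<lbrakk>p \<in> R d; d \<le> D; \<bar>c\<bar> \<le> M\<rbrakk>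
        \<Longrightarrow> s p - of_int c \<notin> {min (s k) t..max (s k) t}"
begin

text \<open>Only \<open>j = k\<close> matters, and a flip there would put a shifted frozen stamp
  between \<open>s k\<close> and \<open>t\<close>, against \<open>hidden_shift\<close>.\<close>

lemma guard_sat_change:
  assumes "range \<nu> \<subseteq> s ` R d" "d \<le> D" "guard_bound g \<le> M"
  shows "guard_sat \<nu> ((s(k := t)) j) g = guard_sat \<nu> (s j) g"
proof (rule ccontr)
  assume neq: "\<not> ?thesis"
  then have "j = k"
    by (auto split: if_splits)
  with neq have "guard_sat \<nu> (s k) g \<noteq> guard_sat \<nu> t g"
    by auto
  then obtain x c where "\<bar>c\<bar> \<le> guard_bound g" "\<nu> x - of_int c \<in> {min (s k) t..max (s k) t}"
    using guard_sat_differ by blast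
  moreover obtain p where "p \<in> R d" "\<nu> x = s p"
    using assms(1) by blast
  ultimately show False
    using hidden_shift[of p d c] assms by auto
qed

lemma gevent_sat_change:
  assumes "range \<nu> \<subseteq> s ` R d" "d \<le> D" "guard_bound (snd \<theta>) \<le> M" "j < n"
  shows "gevent_sat (unary_word a n (s(k := t))) j \<nu> \<theta> = gevent_sat (unary_word a n s) j \<nu> \<theta>"
  using guard_sat_change[OF assms(1-3), of j] assms(4) by (auto simp: gevent_sat_def)

text \<open>The letters agree, so the guard flips; its threshold, an integer shift of a frozen
  stamp, falls between the two stamps and \<open>reachable_shift\<close> applies.\<close>

lemma gevent_sat_adjacent_differ:
  assumes "range \<nu> \<subseteq> s ` R d" "guard_bound (snd \<theta>) \<le> M" "Suc j < n"
    and "gevent_sat (unary_word a n s) j \<nu> \<theta> \<noteq> gevent_sat (unary_word a n s) (Suc j) \<nu> \<theta>"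
  shows "j \<in> R (Suc d) \<and> Suc j \<in> R (Suc d)"
proof -
  have "guard_sat \<nu> (s j) (snd \<theta>) \<noteq> guard_sat \<nu> (s (Suc j)) (snd \<theta>)"
    using assms(3,4) by (auto simp: gevent_sat_def)
  then obtain x c where "\<bar>c\<bar> \<le> guard_bound (snd \<theta>)"
    "\<nu> x - of_int c \<in> {min (s j) (s (Suc j))..max (s j) (s (Suc j))}"
    using guard_sat_differ by blast
  moreover obtain p where "p \<in> R d" "\<nu> x = s p"
    using assms(1) by blast
  ultimately show ?thesis
    using reachable_shift[of p d c j] assms by auto
qed

text \<open>Either the event is adjacent to \<open>i\<close>, or the position just before it fails
  \<open>\<theta>\<close> and the guard flips there.\<close>

lemma next_event_reachable:
  assumes "range \<nu> \<subseteq> s ` R d" "guard_bound (snd \<theta>) \<le> M" "i \<in> R d"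
    and "i < j" "j < n" "gevent_sat (unary_word a n s) j \<nu> \<theta>"
    and "\<forall>l. i < l \<and> l < j \<longrightarrow> \<not> gevent_sat (unary_word a n s) l \<nu> \<theta>"
  shows "j \<in> R (Suc d)"
proof -
  obtain l where j: "j = Suc l"
    using assms(4) by (cases j) auto
  show ?thesis
  proof (cases "l = i")
    case True
    then show ?thesis using reachable_succ assms j by blast
  next
    case False
    then have "\<not> gevent_sat (unary_word a n s) l \<nu> \<theta>"
      using assms(4,7) j by auto
    then show ?thesis
      using gevent_sat_adjacent_differ[OF assms(1,2), of l a] assms(5,6) j by auto
  qed
qed

lemma previous_event_reachable:
  assumes "range \<nu> \<subseteq> s ` R d" "guard_bound (snd \<theta>) \<le> M" "i \<in> R d"
    and "j < i" "gevent_sat (unary_word a n s) j \<nu> \<theta>"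
    and "\<forall>l. j < l \<and> l < i \<longrightarrow> \<not> gevent_sat (unary_word a n s) l \<nu> \<theta>"
  shows "j \<in> R (Suc d)"
proof (cases "Suc j = i")
  case True
  then show ?thesis using reachable_pred assms by blast
next
  case False
  then have "\<not> gevent_sat (unary_word a n s) (Suc j) \<nu> \<theta>" "Suc j < n"
    using assms(4,6) reachable_bounded[OF assms(3)] by auto
  then show ?thesis
    using gevent_sat_adjacent_differ[OF assms(1,2), of j a] assms(5) by auto
qed

text \<open>Induction with the invariant that the current position and all frozen stamps come from
  \<open>R d\<close>; each \<open>TX\<close> or \<open>TY\<close> trades one unit of remaining depth
  for one level of \<open>R\<close>.\<close>

lemma ttl_sat_change:
  assumes "range \<nu> \<subseteq> s ` R d" "i \<in> R d" "ttl_bound \<phi> \<le> M" "ttl_depth \<phi> + d \<le> D"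
  shows "ttl_sat (unary_word a n (s(k := t))) i \<nu> \<phi> = ttl_sat (unary_word a n s) i \<nu> \<phi>"
proof -
  define s' where "s' = s(k := t)"
  show ?thesis
    using assms unfolding s'_def[symmetric]
  proof (induction \<phi> arbitrary: i \<nu> d)
    case (TEvent \<theta>)
    then have "gevent_sat (unary_word a n s') i \<nu> \<theta> = gevent_sat (unary_word a n s) i \<nu> \<theta>"
      by (intro gevent_sat_change[folded s'_def] reachable_bounded) auto
    then show ?case by (simp only: ttl_sat.simps)
  next
    case (TSP \<phi>)
    then show ?case using first_reachable by simp
  next
    case (TEP \<phi>)
    then show ?case using last_reachable by simp
  next
    case (TX \<theta> \<phi>)
    have range: "range \<nu> \<subseteq> s ` R (Suc d)"
      using TX.prems(1) reachable_mono by blast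
    have ev: "gevent_sat (unary_word a n s') l \<nu> \<theta> = gevent_sat (unary_word a n s) l \<nu> \<theta>"
      if "l < n" for l
      using that TX.prems(3,4) by (intro gevent_sat_change[folded s'_def, OF TX.prems(1)]) auto
    \<comment> \<open>By \<open>ev\<close> both words select the same \<open>j\<close>; it lies in
      \<open>R (Suc d)\<close>, where the induction hypothesis applies.\<close>
    have sub: "ttl_sat (unary_word a n s') j \<nu> \<phi> = ttl_sat (unary_word a n s) j \<nu> \<phi>"
      if "i < j" "j < n" "gevent_sat (unary_word a n s) j \<nu> \<theta>"
        "\<forall>l. i < l \<and> l < j \<longrightarrow> \<not> gevent_sat (unary_word a n s) l \<nu> \<theta>" for j
      using next_event_reachable[OF TX.prems(1) _ TX.prems(2) that] TX.IH[OF range] TX.prems by simp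
    show ?case
      unfolding ttl_sat.simps length_unary_word using ev sub by (meson less_trans)
  next
    case (TY \<theta> \<phi>)
    have range: "range \<nu> \<subseteq> s ` R (Suc d)"
      using TY.prems(1) reachable_mono by blast
    have ev: "gevent_sat (unary_word a n s') l \<nu> \<theta> = gevent_sat (unary_word a n s) l \<nu> \<theta>"
      if "l < i" for l
      using that TY.prems(3,4) reachable_bounded[OF TY.prems(2)]
      by (intro gevent_sat_change[folded s'_def, OF TY.prems(1)]) auto
    have sub: "ttl_sat (unary_word a n s') j \<nu> \<phi> = ttl_sat (unary_word a n s) j \<nu> \<phi>"
      if "j < i" "gevent_sat (unary_word a n s) j \<nu> \<theta>"
        "\<forall>l. j < l \<and> l < i \<longrightarrow> \<not> gevent_sat (unary_word a n s) l \<nu> \<theta>" for j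
      using previous_event_reachable[OF TY.prems(1) _ TY.prems(2) that] TY.IH[OF range] TY.prems
      by simp
    show ?case
      unfolding ttl_sat.simps using ev sub by meson
  next
    case (TFreeze x \<phi>)
    \<comment> \<open>The current position is reachable, hence not \<open>k\<close>: both words
      freeze the same value, and the changed stamp is never frozen.\<close>
    have "s' i = s i" "i < n"
      using hidden[of d] TFreeze.prems reachable_bounded by (auto simp: s'_def)
    moreover have "range (\<nu>(x := s i)) \<subseteq> s ` R d"
      using TFreeze.prems by (auto split: if_splits)
    then have "ttl_sat (unary_word a n s') i (\<nu>(x := s i)) \<phi>
        = ttl_sat (unary_word a n s) i (\<nu>(x := s i)) \<phi>"
      using TFreeze.prems by (intro TFreeze.IH) auto
    ultimately show ?case
      by simp
  qed simp_all
qed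

lemma ttl_lang_change:
  assumes "ttl_bound \<psi> \<le> M" "ttl_depth \<psi> \<le> D" "s 0 = 0"
    and "timed_word (unary_word a n s)" "timed_word (unary_word a n (s(k := t)))"
  shows "unary_word a n (s(k := t)) \<in> ttl_lang \<psi> \<longleftrightarrow> unary_word a n s \<in> ttl_lang \<psi>"
proof -
  \<comment> \<open>The initial valuation counts as the stamp of position \<open>0\<close>.\<close>
  have "range (\<lambda>_. 0) \<subseteq> s ` R 0"
    using first_reachable[of 0] assms(3) by force
  then show ?thesis
    using ttl_sat_change[OF _ first_reachable, of "\<lambda>_. 0" 0 \<psi> a] assms by (simp add: ttl_lang_def)
qed

end

section \<open>Separating BMTL from TTL\<close>

text \<open>Residues modulo \<open>2 * m + 1\<close> form a cycle; wrapping between \<open>0\<close>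
  and \<open>2 * m\<close> is harmless because both lie at distance \<open>m\<close> from the
  centre.\<close>

lemma mod_dist_centre:
  fixes q q' m :: int
  assumes "0 \<le> m" "\<bar>q' - q\<bar> \<le> 1"
  shows "\<bar>q mod (2 * m + 1) - m\<bar> \<le> \<bar>q' mod (2 * m + 1) - m\<bar> + 1"
proof -
  define L where "L = 2 * m + 1"
  then have "0 < L"
    using assms by simp
  then have bnd: "0 \<le> q mod L" "q mod L < L"
    by simp_all
  define u where "u = q mod L + (q' - q)"
  have q': "q' mod L = u mod L"
    unfolding u_def by (simp add: mod_simps)
  \<comment> \<open>\<open>u\<close> ranges over \<open>-1..L\<close>, so at most one wrap
    occurs.\<close>
  have "u mod L = (if u < 0 then L - 1 else if u = L then 0 else u)"
  proof -
    have "u mod L = L - 1" if "u < 0"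
    proof -
      have "u = - 1" using that bnd assms by (auto simp: u_def)
      then show ?thesis using assms by (simp add: L_def zmod_minus1)
    qed
    moreover have "u mod L = u" if "0 \<le> u" "u \<noteq> L"
      using that bnd assms by (auto simp: u_def)
    ultimately show ?thesis by auto
  qed
  then have "\<bar>q mod L - m\<bar> \<le> \<bar>q' mod L - m\<bar> + 1"
    unfolding q' using bnd assms u_def L_def by (smt (verit))
  then show ?thesis
    by (simp add: L_def)
qed

lemma BMTL_not_TTL: "\<exists>\<phi> \<in> (BMTL :: 'a mtl set). \<not> (\<exists>\<psi> :: 'a ttl. ttl_lang \<psi> = mtl_lang \<phi>)"
proof -
  fix a :: 'a
  define \<phi> where "\<phi> = MF (IvlOO 0 1) (MF (IvlCC 1 1) (MAtom a))"
  have "\<phi> \<in> BMTL"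
    by (simp add: \<phi>_def BMTL_def ivl_bounded_def)
  moreover have False if eq: "ttl_lang \<psi> = mtl_lang \<phi>" for \<psi>
  proof -
    define D M where "D = ttl_depth \<psi>" and "M = ttl_bound \<psi>"
    define m where "m = Suc D"
    define L where "L = 2 * m + 1"
    \<comment> \<open>Two blocks of \<open>L\<close> stamps: multiples of \<open>1 / L\<close> below
      \<open>1\<close>, then stamps in \<open>(1,2)\<close> offset by half a step, so that no two
      differ by exactly \<open>1\<close>.\<close>
    define s :: "nat \<Rightarrow> real" where "s j = (if j < L then j / L else (j + 1/2) / L)" for j
    \<comment> \<open>This is \<open>s m + 1\<close>, half a step below the stamp at
      \<open>L + m\<close> that it replaces.\<close>
    define t :: real where "t = (L + m) / L"
    \<comment> \<open>Positions whose residue modulo \<open>L\<close> is within \<open>d\<close> of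
      an end of \<open>0..2 * m\<close>. Integer time shifts preserve the residue up to rounding,
      and \<open>m = Suc D\<close> keeps the centre residue out up to level
      \<open>D\<close>.\<close>
    define R where "R d = {i. i < 2 * L \<and> int m \<le> \<bar>int i mod int L - int m\<bar> + int d}" for d
    have L: "0 < L" "int L = 2 * int m + 1"
      by (auto simp: L_def)
    \<comment> \<open>\<open>q\<close> is a virtual index, \<open>i\<close> moved by a multiple of
      \<open>L\<close> as a time shift does; it may lie outside the word.\<close>
    have near: "j \<in> R (Suc d)" if "i \<in> R d" "j < 2 * L" "\<bar>int j - q\<bar> \<le> 1" "q mod int L = int i mod int L"
      for i j d q
      using that mod_dist_centre[of "int m" "int j" q] L by (auto simp: R_def)
    have mod_m: "int (L + m) mod int L = int m"
    proof -
      have "m < L" by (simp add: L_def)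
      then show ?thesis by simp
    qed
    \<comment> \<open>The offset in units of \<open>1 / L\<close>; being below \<open>1\<close>, it
      disappears when inequalities between indices are rounded to integers.\<close>
    define h :: "nat \<Rightarrow> real" where "h j = (if j < L then 0 else 1/2)" for j
    have s_eq: "s j = (j + h j) / L" and h: "h j = 0 \<or> h j = 1/2" and h_mono: "h j \<le> h (Suc j)" for j
      by (auto simp: s_def h_def)
    have shift: "s p - of_int c = (of_int (int p - c * int L) + h p) / L" for p c
      using L(1) by (simp add: s_eq field_simps)
    have s_mono: "s j \<le> s (Suc j)" for j
      using L h_mono[of j] by (simp add: s_eq divide_right_mono)
    interpret hidden_change "2 * L" "L + m" D s t M R
    proof
      fix d show "0 \<in> R d" using L by (simp add: R_def)
    next
      fix d
      have "int (2 * L - 1) mod int L = int L - 1"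
      proof -
        have "int (2 * L - 1) = int L - 1 + int L" using L by simp
        then have "int (2 * L - 1) mod int L = (int L - 1) mod int L" by (simp only: mod_add_self2)
        also have "\<dots> = int L - 1" using L(1) by (intro mod_pos_pos_trivial) auto
        finally show ?thesis .
      qed
      then show "2 * L - 1 \<in> R d" using L by (simp add: R_def)
    next
      fix p d c j
      assume p: "p \<in> R d" and j: "Suc j < 2 * L"
        and "s p - of_int c \<in> {min (s j) (s (Suc j))..max (s j) (s (Suc j))}"
      then have *: "s j \<le> s p - of_int c" "s p - of_int c \<le> s (Suc j)"
        using s_mono[of j] by auto
      define q where "q = int p - c * int L"
      have "j + h j \<le> of_int q + h p" "of_int q + h p \<le> Suc j + h (Suc j)"
        using * L unfolding shift q_def[symmetric] by (simp_all add: s_eq divide_le_cancel)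
      then have "real_of_int (int j) < of_int (q + 1)" "of_int q < real_of_int (int j + 2)"
        using h[of j] h[of p] h[of "Suc j"] by auto
      then have "int j \<le> q" "q \<le> int j + 1"
        by linarith+
      moreover have "q mod int L = int p mod int L"
        using mod_mult_self1[of "int p" "- c" "int L"] by (simp add: q_def)
      ultimately show "j \<in> R (Suc d) \<and> Suc j \<in> R (Suc d)"
        using near[OF p, of j q] near[OF p, of "Suc j" q] j by auto
    next
      fix d assume "d \<le> D"
      then show "L + m \<notin> R d" unfolding R_def mem_Collect_eq mod_m by (simp add: m_def)
    next
      fix p d c
      assume p: "p \<in> R d" "d \<le> D"
      show "s p - of_int c \<notin> {min (s (L + m)) t..max (s (L + m)) t}"
      proof
        assume asm: "s p - of_int c \<in> {min (s (L + m)) t..max (s (L + m)) t}"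
        have "s (L + m) = (L + m + 1/2) / L"
          by (simp add: s_def)
        moreover from this have "t \<le> s (L + m)"
          using L by (simp add: t_def divide_right_mono)
        ultimately have *: "(L + m) / L \<le> s p - of_int c" "s p - of_int c \<le> (L + m + 1/2) / L"
          using asm by (auto simp: t_def)
        define q where "q = int p - c * int L"
        \<comment> \<open>Rounding leaves only \<open>q = L + m\<close>, which has the centre
          residue; no position of \<open>R d\<close> with \<open>d \<le> D\<close> has it.\<close>
        have "L + m \<le> of_int q + h p" "of_int q + h p \<le> L + m + 1/2"
          using * L unfolding shift q_def[symmetric] by (simp_all add: divide_le_cancel)
        then have "real_of_int (int (L + m)) < of_int (q + 1)" "of_int q < real_of_int (int (L + m) + 1)"
          using h[of p] by auto
        then have "q = int (L + m)"
          by linarith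
        moreover have "q mod int L = int p mod int L"
          using mod_mult_self1[of "int p" "- c" "int L"] by (simp add: q_def)
        ultimately have "int p mod int L = int m"
          using mod_m by simp
        then show False
          using p by (simp add: R_def m_def)
      qed
    next
      fix d i assume "i \<in> R d" "Suc i < 2 * L"
      then show "Suc i \<in> R (Suc d)" using near[of i d "Suc i" "int i"] by simp
    next
      fix d i assume "Suc i \<in> R d"
      then show "i \<in> R (Suc d)" using near[of "Suc i" d i "int (Suc i)"] by (simp add: R_def)
    qed (auto simp: R_def)
    let ?w = "unary_word a (2 * L) s" and ?w' = "unary_word a (2 * L) (s(L + m := t))"
    have "s i \<le> t" if "Suc i = L + m" for i
    proof -
      have "real i + 1 = L + m" using that by linarith
      then show ?thesis using L(1) by (auto simp: s_def t_def divide_right_mono)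
    qed
    moreover have "t \<le> s (Suc (L + m))"
      using L by (auto simp: s_def t_def divide_right_mono)
    moreover have s0: "s 0 = 0"
      using L by (simp add: s_def)
    ultimately have tw: "timed_word ?w" "timed_word ?w'"
      using s_mono L by (auto intro!: timed_word_unary_word)
    have "?w' \<in> mtl_lang \<phi>"
    proof -
      \<comment> \<open>Witnesses: position \<open>m\<close>, with stamp strictly between
        \<open>0\<close> and \<open>1\<close>, and position \<open>L + m\<close>, exactly
        \<open>1\<close> later after the change.\<close>
      have "s m = m / L" "0 < m" "m < L" "t - m / L = 1"
        using L by (auto simp: s_def t_def m_def field_simps)
      moreover from this have "mtl_sat ?w' m (MF (IvlCC 1 1) (MAtom a))"
        by (auto intro!: exI[of _ "L + m"])
      ultimately have "mtl_sat ?w' 0 \<phi>"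
        unfolding \<phi>_def
        by (subst mtl_sat.simps) (auto intro!: exI[of _ m] simp: s0 simp del: mtl_sat.simps)
      then show ?thesis
        using tw by (simp add: mtl_lang_def)
    qed
    moreover have "?w \<notin> mtl_lang \<phi>"
    proof
      assume "?w \<in> mtl_lang \<phi>"
      then obtain i j where ij: "i < j" "j < 2 * L" "s i < 1" "s j - s i = 1"
        by (auto simp: mtl_lang_def \<phi>_def s0)
      have "i < L"
        using ij(3) L by (auto simp: s_def field_simps split: if_splits)
      then have "s i + 1 = (i + L) / L"
        using L(1) by (simp add: s_def add_divide_distrib)
      then have "(j + h j) / L = (i + L) / L"
        using ij(4) unfolding s_eq[of j, symmetric] by linarith
      then have sum: "j + h j = i + L"
        using L(1) by simp
      \<comment> \<open>In the first block \<open>j\<close> is too small for the sum; in the second,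
        the offset \<open>1/2\<close> cannot give an integer.\<close>
      show False
      proof (cases "j < L")
        case True
        then show False using sum by (simp add: h_def)
      next
        case False
        then have "real (2 * j + 1) = real (2 * (i + L))"
          using sum by (simp add: h_def)
        then show False
          unfolding of_nat_eq_iff by presburger
      qed
    qed
    ultimately show False
      using ttl_lang_change[of \<psi> a] tw s0 eq by (simp add: D_def M_def)
  qed
  ultimately show ?thesis
    by blast
qed

section \<open>Separating MITL from TTL\<close>

lemma MITL_not_TTL: "\<exists>\<phi> \<in> (MITL :: 'a mtl set). \<not> (\<exists>\<psi> :: 'a ttl. ttl_lang \<psi> = mtl_lang \<phi>)"
proof -
  fix a :: 'a
  define \<phi> where "\<phi> = MF (IvlCInf 0) (MF (IvlOO 1 2) (MAtom a))"
  have "{0..} \<noteq> {c..c}" for c :: real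
  proof
    assume "{0..} = {c..c}"
    moreover have "(0::real) \<in> {0..}" "(1::real) \<in> {0..}" by auto
    ultimately show False by simp
  qed
  moreover have "{1<..<2} \<noteq> {c..c}" for c :: real
  proof
    assume "{1<..<2} = {c..c}"
    moreover have "(4/3::real) \<in> {1<..<2}" "(5/3::real) \<in> {1<..<2}" by auto
    ultimately show False by simp
  qed
  ultimately have "\<phi> \<in> MITL"
    by (simp add: \<phi>_def MITL_def ivl_singular_def)
  moreover have False if eq: "ttl_lang \<psi> = mtl_lang \<phi>" for \<psi>
  proof -
    define D M where "D = ttl_depth \<psi>" and "M = nat (ttl_bound \<psi>)"
    \<comment> \<open>After \<open>D\<close> steps of at most \<open>M + 1\<close> positions from an
      end, a margin of \<open>M + 2\<close> positions to the centre \<open>k\<close> remains, more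
      than a shift by \<open>M\<close> bridges.\<close>
    define k where "k = D * (M + 1) + M + 2"
    define s :: "nat \<Rightarrow> real" where "s j = 3 * j" for j
    \<comment> \<open>Halfway between \<open>s k\<close> and \<open>s (Suc k)\<close>: the gap to
      the next stamp becomes \<open>3/2\<close>, inside \<open>(1,2)\<close>, which contains no
      multiple of \<open>3\<close>.\<close>
    define t :: real where "t = 3 * k + 3/2"
    \<comment> \<open>Positions within \<open>d * (M + 1)\<close> of an end: a shift by at most
      \<open>M\<close>, rounded to a neighbouring position, crosses at most \<open>M / 3 + 1\<close>
      gaps.\<close>
    define R where "R d = {i. i < 2 * k + 1 \<and> int k \<le> \<bar>int i - int k\<bar> + int (d * (M + 1))}" for d
    have near: "j \<in> R (Suc d)" if "i \<in> R d" "j < 2 * k + 1" "\<bar>int j - int i\<bar> \<le> int M + 1" for i j d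
      using that by (auto simp: R_def)
    have far: "int M + 2 \<le> \<bar>int i - int k\<bar>" if "i \<in> R d" "d \<le> D" for i d
    proof -
      have "d * (M + 1) \<le> D * (M + 1)"
        using that(2) by (rule mult_le_mono1)
      moreover have "int k \<le> \<bar>int i - int k\<bar> + int (d * (M + 1))"
        using that(1) by (simp add: R_def)
      ultimately show ?thesis
        unfolding k_def by linarith
    qed
    interpret hidden_change "2 * k + 1" k D s t "int M" R
    proof
      fix p d c j
      assume p: "p \<in> R d" and c: "\<bar>c\<bar> \<le> int M" and j: "Suc j < 2 * k + 1"
        and "s p - of_int c \<in> {min (s j) (s (Suc j))..max (s j) (s (Suc j))}"
      then have "real_of_int (3 * int j) \<le> of_int (3 * int p - c)"
        "of_int (3 * int p - c) \<le> real_of_int (3 * int j + 3)"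
        by (auto simp: s_def)
      then have "3 * int j \<le> 3 * int p - c" "3 * int p - c \<le> 3 * int j + 3"
        unfolding of_int_le_iff by auto
      then show "j \<in> R (Suc d) \<and> Suc j \<in> R (Suc d)"
        using near[OF p, of j] near[OF p, of "Suc j"] c j by auto
    next
      fix d assume "d \<le> D"
      then show "k \<notin> R d" using far[of k d] by auto
    next
      fix p d c
      assume p: "p \<in> R d" "d \<le> D" and c: "\<bar>c\<bar> \<le> int M"
      show "s p - of_int c \<notin> {min (s k) t..max (s k) t}"
      proof
        assume "s p - of_int c \<in> {min (s k) t..max (s k) t}"
        then have "real_of_int (3 * int k) \<le> of_int (3 * int p - c)"
          "of_int (3 * int p - c) < real_of_int (3 * int k + 2)"
          by (auto simp: s_def t_def)
        then have "3 * int k \<le> 3 * int p - c" "3 * int p - c < 3 * int k + 2"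
          unfolding of_int_le_iff of_int_less_iff by auto
        then show False
          using far[OF p] c by auto
      qed
    next
      fix d i assume "i \<in> R d" "Suc i < 2 * k + 1"
      then show "Suc i \<in> R (Suc d)" using near[of i d "Suc i"] by simp
    next
      fix d i assume "Suc i \<in> R d"
      then show "i \<in> R (Suc d)" using near[of "Suc i" d i] by (simp add: R_def)
    qed (auto simp: R_def)
    let ?w = "unary_word a (2 * k + 1) s" and ?w' = "unary_word a (2 * k + 1) (s(k := t))"
    have s0: "s 0 = 0"
      by (simp add: s_def)
    have k: "0 < k"
      by (simp add: k_def)
    have tw: "timed_word ?w" "timed_word ?w'"
      using k by (auto intro!: timed_word_unary_word simp: s_def t_def)
    have "mtl_sat ?w' k (MF (IvlOO 1 2) (MAtom a))"
      using k by (auto intro!: exI[of _ "Suc k"] simp: s_def t_def)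
    then have "mtl_sat ?w' 0 \<phi>"
      using k unfolding \<phi>_def
      by (subst mtl_sat.simps) (auto intro!: exI[of _ k] simp: s_def t_def simp del: mtl_sat.simps)
    then have "?w' \<in> mtl_lang \<phi>"
      using tw by (simp add: mtl_lang_def)
    moreover have "?w \<notin> mtl_lang \<phi>"
    proof
      assume "?w \<in> mtl_lang \<phi>"
      then obtain i j where "1 < s j - s i" "s j - s i < 2"
        by (auto simp: mtl_lang_def \<phi>_def)
      then have "real_of_int 1 < of_int (3 * int j - 3 * int i)"
        "of_int (3 * int j - 3 * int i) < real_of_int 2"
        by (auto simp: s_def)
      then show False
        unfolding of_int_less_iff by presburger
    qed
    ultimately show False
      using ttl_lang_change[of \<psi> a] tw s0 eq ttl_bound_nonneg[of \<psi>] by (simp add: D_def M_def)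
  qed
  ultimately show ?thesis
    by blast
qed

theorem theorem7:
  shows "(\<exists>\<phi> \<in> (BMTL :: 'a::finite mtl set). \<not> (\<exists>\<psi> :: 'a ttl. ttl_lang \<psi> = mtl_lang \<phi>)) \<and>
         (\<exists>\<phi> \<in> (MITL :: 'a::finite mtl set). \<not> (\<exists>\<psi> :: 'a ttl. ttl_lang \<psi> = mtl_lang \<phi>))"
  using BMTL_not_TTL MITL_not_TTL by blast

end
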